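(* Let $(\mathcal U,\rho)$ be a complete metric space and let $f\in W(\mathbf R,\mathcal U)$. Then for any $\epsilon>0$ there exist a sequence $\{T_j\}\in\mathfrak M^{(W)}(\mathrm{Mod}\,f)$ and points $x_j\in\mathcal U$, $j\in\mathbf N$, such that $\rho(f(t),x_j)<\epsilon$ for all $t\in T_j$, $j\in\mathbf N$.
   Context: Below $(X,d)$ denotes a complete metric space (e.g. $\mathcal U$ with $\rho$, or $\mathbf R$ with $|x-y|$). $\mathrm{meas}$ is Lebesgue measure on $\mathbf R$, and measurable sets are Lebesgue measurable. A function $f:\mathbf R\to X$ is elementary if there are points $x_j\in X$ and pairwise disjoint measurable sets $T_j\subset\mathbf R$, $j\in\mathbf N$, with $\mathrm{meas}(\mathbf R\setminus\bigcup_jT_j)=0$ and $f(t)=x_j$ for $t\in T_j$. A function $f:\mathbf R\to X$ is measurable if for every $\epsilon>0$ there is an elementary function $f_\epsilon$ with $\mathrm{ess\,sup}_{t\in\mathbf R}\,d(f(t),f_\epsilon(t))<\epsilon$; $M(\mathbf R,X)$ is the class of measurable functions, functions equal almost everywhere being identified. Put $d'(x,y)=\min\{1,d(x,y)\}$ and, for $l>0$, $D^{(d)}_l(f,g)=\sup_{\xi\in\mathbf R}\frac1l\int_\xi^{\xi+l}d'(f(t),g(t))\,dt$. A set $T\subset\mathbf R$ is relatively dense if there is $a>0$ with $[\xi,\xi+a]\cap T\ne\emptyset$ for all $\xi\in\mathbf R$. $W(\mathbf R,X)$ (equi-Weyl almost periodic functions) is the set of $f\in M(\mathbf R,X)$ such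 that for every $\epsilon>0$ there is $l>0$ for which the set of $\tau\in\mathbf R$ with $D^{(d)}_l(f(\cdot),f(\cdot+\tau))<\epsilon$ is relatively dense. For $f\in W(\mathbf R,X)$, a sequence $\tau_j\in\mathbf R$, $j\in\mathbf N$, is $f$-returning if for every $\epsilon>0$ there are $l>0$ and $j_0\in\mathbf N$ with $D^{(d)}_l(f(\cdot),f(\cdot+\tau_j))<\epsilon$ for all $j\ge j_0$. $\mathrm{Mod}\,f$ is the set of $\lambda\in\mathbf R$ such that $e^{i\lambda\tau_j}\to1$ for all $f$-returning sequences $\{\tau_j\}$; it is an additive subgroup (module) of $\mathbf R$. $\chi_T$ is the characteristic function of $T\subset\mathbf R$. $W(\mathbf R)$ is the collection of measurable sets $T\subset\mathbf R$ with $\chi_T\in W(\mathbf R,\mathbf R)$, and $\mathrm{Mod}\,T=\mathrm{Mod}\,\chi_T$ for $T\in W(\mathbf R)$. For bounded measurable $h:\mathbf R\to\mathbf R$, $\|h\|_1=\lim_{l\to+\infty}\sup_{\xi\in\mathbf R}\frac1l\int_\xi^{\xi+l}|h(t)|\,dt$. For an additive subgroup (module) $\Lambda\subset\mathbf R$, $\mathfrak M^{(W)}(\Lambda)$ is the set of sequences $\{T_j\}_{j\in\mathbf N}$ of pairwise disjoint sets $T_j\in W(\mathbf R)$ such that $\mathrm{Mod}\,T_j\subset\Lambda$ for all $j$, $\mathrm{meas}(\mathbf R\setminus\bigcup_jT_j)=0$, and $\|\chi_{\mathbf R\setminus\bigcup_{j\le N}T_j}\|_1\to0$ as $N\to+\infty$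 (finite sequences are included, being completed by empty sets). *)

theory Defs
  imports "HOL-Analysis.Analysis" "HOL-Probability.Essential_Supremum"
begin

text \<open>
  Functions are not quotiented by almost everywhere equality: a member of a function class below
  is an arbitrary representative, and all the notions below are invariant under changing the
  functions on a null set.
\<close>

definition elementary :: "(real \<Rightarrow> 'a) \<Rightarrow> bool" where
  "elementary f \<longleftrightarrow> (\<exists>(x :: nat \<Rightarrow> 'a) (T :: nat \<Rightarrow> real set).
     (\<forall>j. T j \<in> sets lebesgue) \<and> disjoint_family T \<and>
     emeasure lebesgue (UNIV - (\<Union>j. T j)) = 0 \<and>
     (\<forall>j. \<forall>t\<in>T j. f t = x j))"

text \<open>
  The library's \<^const>\<open>esssup\<close> is infinite by convention for a nonmeasurable argument. This
  excludes nothing: if \<open>f\<close> is an essentially uniform limit of elementary functions in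
  the almost everywhere sense, then \<open>f\<close> is almost everywhere a pointwise limit of measurable
  functions with countable range, so \<open>t \<mapsto> dist (f t) (g t)\<close> is Lebesgue measurable for every elementary \<open>g\<close>.
\<close>

definition M_class :: "(real \<Rightarrow> 'a::metric_space) set" where
  "M_class = {f. \<forall>\<epsilon>>0. \<exists>g. elementary g \<and>
     esssup lebesgue (\<lambda>t. ereal (dist (f t) (g t))) < ereal \<epsilon>}"

definition Weyl_D :: "real \<Rightarrow> (real \<Rightarrow> 'a::metric_space) \<Rightarrow> (real \<Rightarrow> 'a) \<Rightarrow> real" where
  "Weyl_D l f g = (SUP \<xi>. (1 / l) * (LINT t:{\<xi>..\<xi> + l}|lebesgue. min 1 (dist (f t) (g t))))"

definition relatively_dense :: "real set \<Rightarrow> bool" where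
  "relatively_dense T \<longleftrightarrow> (\<exists>a>0. \<forall>\<xi>. {\<xi>..\<xi> + a} \<inter> T \<noteq> {})"

definition Weyl_ap :: "(real \<Rightarrow> 'a::metric_space) set" where
  "Weyl_ap = {f \<in> M_class. \<forall>\<epsilon>>0. \<exists>l>0.
     relatively_dense {\<tau>. Weyl_D l f (\<lambda>t. f (t + \<tau>)) < \<epsilon>}}"

definition returning :: "(real \<Rightarrow> 'a::metric_space) \<Rightarrow> (nat \<Rightarrow> real) \<Rightarrow> bool" where
  "returning f \<tau> \<longleftrightarrow> (\<forall>\<epsilon>>0. \<exists>l>0. \<exists>j0. \<forall>j\<ge>j0. Weyl_D l f (\<lambda>t. f (t + \<tau> j)) < \<epsilon>)"

definition Mod_fun :: "(real \<Rightarrow> 'a::metric_space) \<Rightarrow> real set" where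
  "Mod_fun f = {\<mu>. \<forall>\<tau>. returning f \<tau> \<longrightarrow>
     (\<lambda>j. exp (\<i> * complex_of_real (\<mu> * \<tau> j))) \<longlonglongrightarrow> 1}"

definition Weyl_sets :: "real set set" where
  "Weyl_sets = {T \<in> sets lebesgue. (indicator T :: real \<Rightarrow> real) \<in> Weyl_ap}"

definition Mod_set :: "real set \<Rightarrow> real set" where
  "Mod_set T = Mod_fun (indicator T :: real \<Rightarrow> real)"

text \<open>
  For bounded measurable \<open>h\<close> the limit exists, because \<open>l\<close> times the supremum is subadditive in \<open>l\<close>.
\<close>

definition Weyl_norm :: "(real \<Rightarrow> real) \<Rightarrow> real" where
  "Weyl_norm h = Lim at_top (\<lambda>l. SUP \<xi>. (1 / l) * (LINT t:{\<xi>..\<xi> + l}|lebesgue. \<bar>h t\<bar>))"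

text \<open>
  Meant for additive subgroups \<open>\<Lambda>\<close> of the reals, such as \<^term>\<open>Mod_fun f\<close>. Finite sequences
  are the sequences that are eventually empty; the empty set lies in \<^const>\<open>Weyl_sets\<close> and its
  module is \<open>{0}\<close>, so completing by empty sets is always allowed.
\<close>

definition Weyl_partitions :: "real set \<Rightarrow> (nat \<Rightarrow> real set) set" where
  "Weyl_partitions \<Lambda> = {T. (\<forall>j. T j \<in> Weyl_sets) \<and> disjoint_family T \<and>
     (\<forall>j. Mod_set (T j) \<subseteq> \<Lambda>) \<and>
     emeasure lebesgue (UNIV - (\<Union>j. T j)) = 0 \<and>
     (\<lambda>N. Weyl_norm (indicator (UNIV - (\<Union>j\<le>N. T j)))) \<longlonglongrightarrow> 0}"

end

theory Submission
  imports Defs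
begin

text \<open>
  The sets \<open>T j\<close> are balls \<open>{t. dist (f t) (x j) < r j}\<close> made disjoint. The centres come from the
  measurability of \<open>f\<close>: up to a null set, the range of \<open>f\<close> is covered by countably many balls of
  radius \<open>\<epsilon> / 2\<close>. What needs proof is that the radii can be chosen so that the sets are almost
  periodic with module inside that of \<open>f\<close>, and that finitely many of them leave a
  remainder of arbitrarily small Weyl norm.

  A translation by \<open>\<tau>\<close> changes the membership of \<open>t\<close> in a ball only if \<open>dist (f t) (x j)\<close> is
  within \<open>\<delta>\<close> of the radius or \<open>f\<close> itself is displaced by at least \<open>\<delta>\<close>. The second event has small
  mean whenever the Weyl distance between \<open>f\<close> and its translate is small compared with \<open>\<delta>\<close>. The
  first has small mean, for small \<open>\<delta>\<close>, if the radius is well chosen, and for each centre all but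
  countably many radii are: at most \<open>2 / c\<close> radii can have all their shells of upper mean
  above \<open>c\<close> (\<open>finite_thick_radii\<close>). Upper means of disjoint sets need not add up, so this uses that
  functions obtained from \<open>f\<close> by composition with bounded Lipschitz functions are almost periodic and hence
  have nearly the same average over all long windows (\<open>uniform_mean\<close>).

  For well chosen radii every ball is therefore moved little by all translations that move \<open>f\<close>
  little, and this passes to Boolean combinations (\<open>translation_controlled_combine\<close>). Relatively
  dense sets of almost periods of \<open>f\<close> serve for the sets \<open>T j\<close>, and \<open>f\<close>-returning sequences are
  returning for \<open>T j\<close>; the latter is the inclusion of modules
  (\<open>translation_controlled_Weyl_set\<close>).

  For the exhaustion, almost periods move every window into one fixed bounded interval, on which
  countable additivity of Lebesgue measure makes the part missed by the first \<open>N\<close> balls small. The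
  displacement of \<open>f\<close> is absorbed by enlarging the radius, so the balls of radius \<open>\<epsilon> / 2\<close> that
  cover on the fixed interval and the radii \<open>r j > 3 * \<epsilon> / 4\<close> are kept apart
  (\<open>uniformly_small_tail\<close>).
\<close>

section \<open>Measurability of distances\<close>

lemma shift_measurable [measurable]: "(\<lambda>t::real. t + \<tau>) \<in> lebesgue \<rightarrow>\<^sub>M lebesgue"
  using lebesgue_affine_measurable[of "\<lambda>_::real. 1" \<tau>] by (simp add: add.commute)

lemma lebesgue_shift: "distr lebesgue lebesgue (\<lambda>t::real. t + \<tau>) = lebesgue"
  using lebesgue_real_affine[of 1 \<tau>] by (simp add: density_1 add.commute)

lemma AE_shift:
  assumes "AE t in lebesgue. P (t::real)"
  shows "AE t in lebesgue. P (t + \<tau>)"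
proof -
  obtain N where N: "N \<in> null_sets lebesgue" "{t. \<not> P t} \<subseteq> N"
    using assms by (auto simp: eventually_ae_filter)
  have "emeasure (distr lebesgue lebesgue (\<lambda>t. t + \<tau>)) N = 0"
    using N unfolding lebesgue_shift by auto
  then have "(\<lambda>t. t + \<tau>) -` N \<in> null_sets lebesgue"
    using N(1) by (subst (asm) emeasure_distr) (auto intro: measurable_sets[OF shift_measurable, simplified])
  then show ?thesis
    by (rule AE_I') (use N(2) in auto)
qed

lemma lebesgue_measurable_AE_cong:
  fixes h k :: "real \<Rightarrow> real"
  assumes h: "h \<in> borel_measurable lebesgue" and eq: "AE t in lebesgue. h t = k t"
  shows "k \<in> borel_measurable lebesgue"
proof (rule measurableI)
  fix A :: "real set" assume A: "A \<in> sets borel"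
  have "h -` A \<in> sets lebesgue"
    using measurable_sets[OF h A] by simp
  moreover have "AE t in lebesgue. t \<in> h -` A \<longleftrightarrow> t \<in> k -` A"
    using eq by eventually_elim auto
  ultimately show "k -` A \<inter> space lebesgue \<in> sets lebesgue"
    using completion.in_sets_AE[of "h -` A" "k -` A" lborel] by auto
qed simp

text \<open>
  Writing the countably valued approximants as sequences of values composed with a measurable
  index reduces measurability of distances to measurability of functions of two indices. Borel
  measurability of \<open>f\<close> would be the wrong notion: in a nonseparable space it does not make
  \<open>t \<mapsto> dist (f t) (f (t + \<tau>))\<close> measurable by a product argument.
\<close>

definition countably_approximable :: "(real \<Rightarrow> 'a::metric_space) \<Rightarrow> bool" where
  "countably_approximable f \<longleftrightarrow> (\<forall>e>0. \<exists>(x :: nat \<Rightarrow> 'a) i.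
     i \<in> lebesgue \<rightarrow>\<^sub>M count_space UNIV \<and> (AE t in lebesgue. dist (f t) (x (i t)) < e))"

text \<open>
  The index picks the least set of the elementary function containing the point; it is arbitrary
  on the null set that the sets miss.
\<close>

lemma M_class_countably_approximable:
  assumes "f \<in> M_class"
  shows "countably_approximable f"
  unfolding countably_approximable_def
proof (intro allI impI)
  fix e :: real assume "e > 0"
  then obtain g where g: "elementary g" "esssup lebesgue (\<lambda>t. ereal (dist (f t) (g t))) < ereal e"
    using assms by (auto simp: M_class_def)
  have close: "AE t in lebesgue. dist (f t) (g t) < e"
    using esssup_AE[of "\<lambda>t. ereal (dist (f t) (g t))" lebesgue]
    by eventually_elim (use g(2) in \<open>auto dest: le_less_trans\<close>)
  obtain x :: "nat \<Rightarrow> 'a" and T where T: "\<And>j. T j \<in> sets lebesgue"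
    "emeasure lebesgue (UNIV - (\<Union>j. T j)) = 0" "\<And>j t. t \<in> T j \<Longrightarrow> g t = x j"
    using g(1) unfolding elementary_def by blast
  define i where "i t = (LEAST j. t \<in> T j)" for t
  have "Measurable.pred lebesgue (\<lambda>t. t \<in> T j)" for j
    using T(1)[of j] by (simp add: pred_def)
  then have i: "i \<in> lebesgue \<rightarrow>\<^sub>M count_space UNIV"
    unfolding i_def by measurable
  have "UNIV - (\<Union>j. T j) \<in> null_sets lebesgue"
    using T by (intro null_setsI) auto
  then have "AE t in lebesgue. t \<notin> UNIV - (\<Union>j. T j)"
    by (rule AE_not_in)
  with close have "AE t in lebesgue. dist (f t) (x (i t)) < e"
  proof eventually_elim
    case (elim t)
    then have "t \<in> T (i t)" by (auto simp: i_def intro: LeastI)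
    with elim T(3) show ?case by auto
  qed
  with i show "\<exists>(x :: nat \<Rightarrow> 'a) i. i \<in> lebesgue \<rightarrow>\<^sub>M count_space UNIV \<and>
      (AE t in lebesgue. dist (f t) (x (i t)) < e)"
    by blast
qed

lemma countably_approximable_const: "countably_approximable (\<lambda>t. c)"
  unfolding countably_approximable_def
  by (intro allI impI exI[of _ "\<lambda>_. c"] exI[of _ "\<lambda>_. 0"]) auto

lemma countably_approximable_shift:
  assumes "countably_approximable f"
  shows "countably_approximable (\<lambda>t. f (t + \<tau>))"
  unfolding countably_approximable_def
proof (intro allI impI)
  fix e :: real assume "e > 0"
  then obtain x :: "nat \<Rightarrow> 'a" and i where i: "i \<in> lebesgue \<rightarrow>\<^sub>M count_space UNIV"
    "AE t in lebesgue. dist (f t) (x (i t)) < e"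
    using assms unfolding countably_approximable_def by blast
  have "(\<lambda>t. i (t + \<tau>)) \<in> lebesgue \<rightarrow>\<^sub>M count_space UNIV"
    using measurable_compose[OF shift_measurable i(1)] .
  with AE_shift[OF i(2)] show "\<exists>(x :: nat \<Rightarrow> 'a) i. i \<in> lebesgue \<rightarrow>\<^sub>M count_space UNIV \<and>
      (AE t in lebesgue. dist (f (t + \<tau>)) (x (i t)) < e)"
    by blast
qed

text \<open>
  The approximants take countably many values, so the distance between them is a measurable
  function of two measurable indices; the distance between the limits is almost everywhere a
  pointwise limit of such functions, and Lebesgue measure is complete.
\<close>

lemma dist_measurable:
  assumes f: "countably_approximable f" and g: "countably_approximable g"
  shows "(\<lambda>t. dist (f t) (g t)) \<in> borel_measurable lebesgue"
proof -
  have "\<exists>x i. i \<in> lebesgue \<rightarrow>\<^sub>M count_space UNIV \<and>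
      (AE t in lebesgue. dist (h t) ((x :: nat \<Rightarrow> _) (i t)) < inverse (real (Suc n)))"
    if "countably_approximable h" for h :: "real \<Rightarrow> 'a" and n
    using that unfolding countably_approximable_def by simp
  note approx = this
  obtain x i where i: "\<And>n. i n \<in> lebesgue \<rightarrow>\<^sub>M count_space UNIV"
    "\<And>n. AE t in lebesgue. dist (f t) ((x n :: nat \<Rightarrow> 'a) (i n t)) < inverse (real (Suc n))"
    using approx[OF f] by metis
  obtain y j where j: "\<And>n. j n \<in> lebesgue \<rightarrow>\<^sub>M count_space UNIV"
    "\<And>n. AE t in lebesgue. dist (g t) ((y n :: nat \<Rightarrow> 'a) (j n t)) < inverse (real (Suc n))"
    using approx[OF g] by metis
  define h where "h n t = dist (x n (i n t)) (y n (j n t))" for n t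
  have h: "h n \<in> borel_measurable lebesgue" for n
    unfolding h_def
    by (rule measurable_compose_countable[OF _ i(1)[of n]],
        rule measurable_compose_countable[OF _ j(1)[of n]]) simp
  have "AE t in lebesgue. \<forall>n. \<bar>h n t - dist (f t) (g t)\<bar> \<le> 2 * inverse (real (Suc n))"
    unfolding AE_all_countable
  proof
    fix n
    show "AE t in lebesgue. \<bar>h n t - dist (f t) (g t)\<bar> \<le> 2 * inverse (real (Suc n))"
      using i(2)[of n] j(2)[of n]
    proof eventually_elim
      case (elim t)
      then show ?case
        using dist_triangle[of "f t" "g t" "x n (i n t)"] dist_triangle[of "x n (i n t)" "g t" "y n (j n t)"]
          dist_triangle[of "x n (i n t)" "y n (j n t)" "f t"] dist_triangle[of "f t" "y n (j n t)" "g t"]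
        unfolding h_def abs_le_iff by (simp add: dist_commute)
    qed
  qed
  then have "AE t in lebesgue. lim (\<lambda>n. h n t) = dist (f t) (g t)"
  proof eventually_elim
    case (elim t)
    have "(\<lambda>n. 2 * inverse (real (Suc n))) \<longlonglongrightarrow> 2 * 0"
      by (intro tendsto_intros LIMSEQ_inverse_real_of_nat)
    then have "(\<lambda>n. h n t - dist (f t) (g t)) \<longlonglongrightarrow> 0"
      using elim by (intro Lim_null_comparison[OF _ \<open>_ \<longlonglongrightarrow> 2 * 0\<close>[simplified mult_zero_right]]) auto
    then show ?case by (intro limI) (simp add: LIM_zero_iff)
  qed
  moreover have "(\<lambda>t. lim (\<lambda>n. h n t)) \<in> borel_measurable lebesgue"
    using h by measurable
  ultimately show ?thesis
    by (rule lebesgue_measurable_AE_cong[rotated])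
qed

lemma indicator_M_class:
  assumes "S \<in> sets lebesgue"
  shows "(indicator S :: real \<Rightarrow> real) \<in> M_class"
proof -
  have "elementary (indicator S :: real \<Rightarrow> real)"
    unfolding elementary_def
  proof (intro exI conjI)
    show "disjoint_family (\<lambda>j::nat. if j = 0 then S else if j = 1 then - S else {})"
      by (auto simp: disjoint_family_on_def)
    have "(\<Union>j::nat. if j = 0 then S else if j = 1 then - S else {}) = UNIV"
    proof (rule equalityI)
      show "UNIV \<subseteq> (\<Union>j::nat. if j = 0 then S else if j = 1 then - S else {})"
      proof
        fix t show "t \<in> (\<Union>j::nat. if j = 0 then S else if j = 1 then - S else {})"
          by (cases "t \<in> S") (auto intro: UN_I[of 0] UN_I[of 1])
      qed
    qed simp
    then show "emeasure lebesgue (UNIV - (\<Union>j::nat. if j = 0 then S else if j = 1 then - S else {})) = 0"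
      by simp
    show "\<forall>j. \<forall>t\<in>if j = 0 then S else if j = 1 then - S else {}.
        indicator S t = (if j = (0::nat) then 1 else 0 :: real)"
      by auto
    show "\<forall>j. (if j = (0::nat) then S else if j = 1 then - S else {}) \<in> sets lebesgue"
      using assms by (auto simp: Compl_in_sets_lebesgue)
  qed
  moreover have "esssup lebesgue (\<lambda>t::real. ereal (dist (indicator S t :: real) (indicator S t))) \<le> ereal 0"
    by (rule esssup_I) auto
  ultimately show ?thesis
    unfolding M_class_def by (force intro: le_less_trans)
qed

section \<open>Uniform window means\<close>

definition unit_fun :: "(real \<Rightarrow> real) \<Rightarrow> bool" where
  "unit_fun h \<longleftrightarrow> h \<in> borel_measurable lebesgue \<and> (\<forall>t. 0 \<le> h t \<and> h t \<le> 1)"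

text \<open>
  Upper bounds for the suprema in the Weyl distance and the Weyl norm (\<open>mean_le_iff_SUP_le\<close>),
  written without division and without a supremum, so that they can be added and transported along
  pointwise inequalities with no boundedness side conditions.
\<close>

definition mean_le :: "real \<Rightarrow> (real \<Rightarrow> real) \<Rightarrow> real \<Rightarrow> bool" where
  "mean_le l h c \<longleftrightarrow> (\<forall>\<xi>. (LINT t:{\<xi>..\<xi> + l}|lebesgue. h t) \<le> c * l)"

lemma unit_funD:
  assumes "unit_fun h"
  shows "h \<in> borel_measurable lebesgue" "0 \<le> h t" "h t \<le> 1"
  using assms by (auto simp: unit_fun_def)

lemma unit_fun_indicator: "S \<in> sets lebesgue \<Longrightarrow> unit_fun (indicator S)"
  by (auto simp: unit_fun_def indicator_def[abs_def])

lemma unit_fun_shift: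
  assumes "unit_fun h"
  shows "unit_fun (\<lambda>t. h (t + \<tau>))"
  using assms measurable_compose[OF shift_measurable[of \<tau>], of h] by (auto simp: unit_fun_def)

lemma unit_fun_abs_diff:
  assumes "unit_fun h" "unit_fun k"
  shows "unit_fun (\<lambda>t. \<bar>h t - k t\<bar>)"
proof -
  have [measurable]: "h \<in> borel_measurable lebesgue" "k \<in> borel_measurable lebesgue"
    using assms by (auto simp: unit_fun_def)
  have "(\<lambda>t. \<bar>h t - k t\<bar>) \<in> borel_measurable lebesgue" by measurable
  moreover have "\<bar>h t - k t\<bar> \<le> 1" for t
    using assms unfolding unit_fun_def by (smt (verit))
  ultimately show ?thesis by (auto simp: unit_fun_def)
qed

lemma unit_fun_min_dist:
  assumes "countably_approximable f" "countably_approximable g"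
  shows "unit_fun (\<lambda>t. min 1 (dist (f t) (g t)))"
proof -
  have [measurable]: "(\<lambda>t. dist (f t) (g t)) \<in> borel_measurable lebesgue"
    using assms by (rule dist_measurable)
  have "(\<lambda>t. min 1 (dist (f t) (g t))) \<in> borel_measurable lebesgue" by measurable
  then show ?thesis by (auto simp: unit_fun_def)
qed

lemma set_integrable_one: "set_integrable lebesgue {a..b::real} (\<lambda>_. 1 :: real)"
proof -
  have "integrable lebesgue (indicator {a..b} :: real \<Rightarrow> real)"
    by (intro integrable_real_indicator) (auto simp: emeasure_lborel_Icc_eq)
  then show ?thesis by (simp add: set_integrable_def)
qed

lemma unit_fun_set_integrable:
  assumes "unit_fun h"
  shows "set_integrable lebesgue {a..b} h"
proof -
  have [measurable]: "h \<in> borel_measurable lebesgue" "{a..b} \<in> sets lebesgue"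
    using assms by (auto simp: unit_fun_def)
  have "set_borel_measurable lebesgue {a..b} h"
    unfolding set_borel_measurable_def by measurable
  then show ?thesis
    by (rule set_integrable_bound[OF set_integrable_one])
      (use unit_funD[OF assms] in auto)
qed

lemma window_integral_le:
  assumes h: "unit_fun h" and k: "\<And>t. h t \<le> k1 t + B * k2 t"
    and k1: "unit_fun k1" and k2: "unit_fun k2"
  shows "(LINT t:{a..b}|lebesgue. h t) \<le>
    (LINT t:{a..b}|lebesgue. k1 t) + B * (LINT t:{a..b}|lebesgue. k2 t)"
proof -
  note int = unit_fun_set_integrable[OF h] unit_fun_set_integrable[OF k1]
    unit_fun_set_integrable[OF k2]
  have "(LINT t:{a..b}|lebesgue. h t) \<le> (LINT t:{a..b}|lebesgue. k1 t + B * k2 t)"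
    using int k by (intro set_integral_mono set_integral_add) auto
  also have "\<dots> = (LINT t:{a..b}|lebesgue. k1 t) + B * (LINT t:{a..b}|lebesgue. k2 t)"
    using int by (subst set_integral_add(2)) auto
  finally show ?thesis .
qed

lemma window_integral_bounds:
  assumes "unit_fun h" "a \<le> b"
  shows "0 \<le> (LINT t:{a..b}|lebesgue. h t)" "(LINT t:{a..b}|lebesgue. h t) \<le> b - a"
proof -
  show "0 \<le> (LINT t:{a..b}|lebesgue. h t)"
    unfolding set_lebesgue_integral_def
    by (rule integral_nonneg_AE) (use unit_funD[OF assms(1)] in auto)
  have "(LINT t:{a..b}|lebesgue. h t) \<le> (LINT t:{a..b}|lebesgue. 1 :: real)"
    using unit_funD[OF assms(1)] unit_fun_set_integrable[OF assms(1)] set_integrable_one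
    by (intro set_integral_mono) auto
  also have "\<dots> = b - a"
    using assms(2) by (simp add: set_lebesgue_integral_def)
  finally show "(LINT t:{a..b}|lebesgue. h t) \<le> b - a" .
qed

lemma window_integral_subadditive:
  assumes h: "unit_fun h" and sub: "{a..b} \<subseteq> {c..d} \<union> {e..f}"
  shows "(LINT t:{a..b}|lebesgue. h t) \<le>
    (LINT t:{c..d}|lebesgue. h t) + (LINT t:{e..f}|lebesgue. h t)"
proof -
  note int = unit_fun_set_integrable[OF h, unfolded set_integrable_def]
  have "(LINT t:{a..b}|lebesgue. h t) \<le>
      (LINT t|lebesgue. indicator {c..d} t *\<^sub>R h t + indicator {e..f} t *\<^sub>R h t)"
    unfolding set_lebesgue_integral_def
  proof (rule integral_mono)
    fix t
    have "indicator {a..b} t \<le> indicator {c..d} t + (indicator {e..f} t :: real)"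
      using sub by (auto simp: indicator_def)
    then show "indicator {a..b} t *\<^sub>R h t \<le> indicator {c..d} t *\<^sub>R h t + indicator {e..f} t *\<^sub>R h t"
      using unit_funD(2)[OF h, of t] by (simp add: distrib_right[symmetric] mult_right_mono)
  qed (use int in auto)
  also have "\<dots> = (LINT t:{c..d}|lebesgue. h t) + (LINT t:{e..f}|lebesgue. h t)"
    unfolding set_lebesgue_integral_def by (rule Bochner_Integration.integral_add) (use int in auto)
  finally show ?thesis .
qed

lemma window_integral_subset:
  assumes h: "unit_fun h" and sub: "{a..b} \<subseteq> {c..d}"
  shows "(LINT t:{a..b}|lebesgue. h t) \<le> (LINT t:{c..d}|lebesgue. h t)"
  using window_integral_subadditive[OF h, of a b c d 1 0] sub by (simp add: set_lebesgue_integral_def)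

lemma window_integral_shift:
  assumes "unit_fun h"
  shows "(LINT t:{a..b}|lebesgue. h (t + \<tau>)) = (LINT t:{a + \<tau>..b + \<tau>}|lebesgue. h t)"
proof -
  have [measurable]: "h \<in> borel_measurable lebesgue" "{a + \<tau>..b + \<tau>} \<in> sets lebesgue"
    using assms by (auto simp: unit_fun_def)
  have "(LINT t:{a + \<tau>..b + \<tau>}|lebesgue. h t) =
      (LINT t:{a + \<tau>..b + \<tau>}|distr lebesgue lebesgue (\<lambda>t. t + \<tau>). h t)"
    by (simp only: lebesgue_shift)
  also have "\<dots> = (LINT t|lebesgue. indicator {a + \<tau>..b + \<tau>} (t + \<tau>) *\<^sub>R h (t + \<tau>))"
    unfolding set_lebesgue_integral_def by (rule integral_distr) auto
  also have "\<dots> = (LINT t:{a..b}|lebesgue. h (t + \<tau>))"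
    unfolding set_lebesgue_integral_def
    by (rule Bochner_Integration.integral_cong) (auto simp: indicator_def)
  finally show ?thesis by simp
qed

lemma mean_leI:
  "(\<And>\<xi>. (LINT t:{\<xi>..\<xi> + l}|lebesgue. h t) \<le> c * l) \<Longrightarrow> mean_le l h c"
  by (simp add: mean_le_def)

lemma mean_leD:
  "mean_le l h c \<Longrightarrow> (LINT t:{\<xi>..\<xi> + l}|lebesgue. h t) \<le> c * l"
  by (simp add: mean_le_def)

lemma mean_le_mono_bound: "mean_le l h c \<Longrightarrow> c \<le> d \<Longrightarrow> 0 \<le> l \<Longrightarrow> mean_le l h d"
  unfolding mean_le_def by (meson mult_right_mono order_trans)

lemma mean_le_combine:
  assumes "unit_fun h" "\<And>t. h t \<le> k1 t + B * k2 t" "unit_fun k1" "unit_fun k2"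
    and "mean_le l k1 c1" "mean_le l k2 c2" "B \<ge> 0"
  shows "mean_le l h (c1 + B * c2)"
proof (rule mean_leI)
  fix \<xi>
  have "(LINT t:{\<xi>..\<xi> + l}|lebesgue. h t) \<le>
      (LINT t:{\<xi>..\<xi> + l}|lebesgue. k1 t) + B * (LINT t:{\<xi>..\<xi> + l}|lebesgue. k2 t)"
    using assms by (intro window_integral_le) auto
  also have "\<dots> \<le> c1 * l + B * (c2 * l)"
    using mean_leD[OF assms(5)] mean_leD[OF assms(6)] assms(7)
    by (intro add_mono mult_left_mono) auto
  finally show "(LINT t:{\<xi>..\<xi> + l}|lebesgue. h t) \<le> (c1 + B * c2) * l"
    by (simp add: algebra_simps)
qed

text \<open>
  A long window is covered by fewer than \<open>L / l + 1\<close> windows of length \<open>l\<close>. This makes bounds at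
  different scales comparable: smallness at one scale persists, up to a factor two, at all larger
  scales.
\<close>

lemma mean_le_long_window:
  assumes h: "unit_fun h" and m: "mean_le l h c" and "l > 0" "L > 0" "c \<ge> 0"
  shows "(LINT t:{\<xi>..\<xi> + L}|lebesgue. h t) \<le> c * (L + l)"
proof -
  have steps: "(LINT t:{\<xi>..\<xi> + real n * l}|lebesgue. h t) \<le> real n * (c * l)" if "n > 0" for n
    using that
  proof (induction n rule: nat_induct_non_zero)
    case 1 then show ?case using mean_leD[OF m, of \<xi>] by simp
  next
    case (Suc n)
    have "(LINT t:{\<xi>..\<xi> + real (Suc n) * l}|lebesgue. h t) \<le>
        (LINT t:{\<xi>..\<xi> + real n * l}|lebesgue. h t) +
        (LINT t:{\<xi> + real n * l..\<xi> + real n * l + l}|lebesgue. h t)"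
      by (rule window_integral_subadditive[OF h]) (auto simp: algebra_simps)
    with Suc mean_leD[OF m, of "\<xi> + real n * l"] show ?case
      by (simp add: algebra_simps)
  qed
  define n where "n = nat \<lceil>L / l\<rceil>"
  have "L / l > 0" using assms by simp
  then have n: "n > 0" "L / l \<le> real n" "real n \<le> L / l + 1"
    unfolding n_def by linarith+
  have nl: "L \<le> real n * l" "real n * l \<le> L + l"
    using n assms(3) by (auto simp: field_simps)
  have "(LINT t:{\<xi>..\<xi> + L}|lebesgue. h t) \<le> (LINT t:{\<xi>..\<xi> + real n * l}|lebesgue. h t)"
    by (rule window_integral_subset[OF h]) (use nl in auto)
  also have "\<dots> \<le> c * (real n * l)"
    using steps[OF n(1)] by (simp add: algebra_simps)
  also have "\<dots> \<le> c * (L + l)"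
    using nl assms by (intro mult_left_mono) auto
  finally show ?thesis .
qed

lemma mean_le_larger_scale:
  assumes "unit_fun h" "mean_le l h c" "l > 0" "l \<le> L" "c \<ge> 0"
  shows "mean_le L h (2 * c)"
proof (rule mean_leI)
  fix \<xi>
  have "(LINT t:{\<xi>..\<xi> + L}|lebesgue. h t) \<le> c * (L + l)"
    using assms by (intro mean_le_long_window) auto
  also have "\<dots> \<le> c * (2 * L)"
    using assms by (intro mult_left_mono) auto
  finally show "(LINT t:{\<xi>..\<xi> + L}|lebesgue. h t) \<le> 2 * c * L"
    by (simp add: algebra_simps)
qed

lemma window_average_bdd_above:
  assumes "unit_fun h" "l > 0"
  shows "bdd_above (range (\<lambda>\<xi>. (1 / l) * (LINT t:{\<xi>..\<xi> + l}|lebesgue. h t)))"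
proof (rule bdd_aboveI2)
  fix \<xi>
  show "(1 / l) * (LINT t:{\<xi>..\<xi> + l}|lebesgue. h t) \<le> 1"
    using window_integral_bounds(2)[OF assms(1), of \<xi> "\<xi> + l"] assms(2) by (simp add: field_simps)
qed

lemma mean_le_iff_SUP_le:
  assumes "unit_fun h" "l > 0"
  shows "mean_le l h c \<longleftrightarrow> (SUP \<xi>. (1 / l) * (LINT t:{\<xi>..\<xi> + l}|lebesgue. h t)) \<le> c"
  using assms by (subst cSUP_le_iff[OF _ window_average_bdd_above]) (auto simp: mean_le_def field_simps)

lemma Weyl_D_le_iff:
  assumes "countably_approximable f" "countably_approximable g" "l > 0"
  shows "Weyl_D l f g \<le> c \<longleftrightarrow> mean_le l (\<lambda>t. min 1 (dist (f t) (g t))) c"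
  unfolding Weyl_D_def using mean_le_iff_SUP_le[OF unit_fun_min_dist[OF assms(1,2)] assms(3)] by simp

text \<open>
  The suprema over windows of length \<open>L\<close> converge to their infimum: covering long windows by
  windows whose length nearly attains the infimum gives the upper bound. Hence a bound at a single
  scale bounds the Weyl norm.
\<close>

lemma Weyl_norm_bounds:
  assumes h: "unit_fun h" and bound: "mean_le l h c" and l: "l > 0"
  shows "0 \<le> Weyl_norm h" "Weyl_norm h \<le> c"
proof -
  define um where "um L = (SUP \<xi>. (1 / L) * (LINT t:{\<xi>..\<xi> + L}|lebesgue. h t))" for L
  have um_le: "mean_le L h d \<longleftrightarrow> um L \<le> d" if "L > 0" for L d
    unfolding um_def using mean_le_iff_SUP_le[OF h that] .
  have um0: "0 \<le> um L" if "L > 0" for L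
    unfolding um_def
    by (rule cSUP_upper2[OF window_average_bdd_above[OF h that], of 0])
      (use window_integral_bounds(1)[OF h, of 0 L] that in auto)
  define m where "m = (INF L\<in>{0<..}. um L)"
  have bdd: "bdd_below (um ` {0<..})"
    using um0 by (intro bdd_belowI2[of _ 0]) auto
  have m_le: "m \<le> um L" if "L > 0" for L
    unfolding m_def using bdd that by (intro cINF_lower) auto
  have m0: "0 \<le> m"
    unfolding m_def using um0 by (intro cINF_greatest) auto
  have "(um \<longlongrightarrow> m) at_top"
  proof (rule tendstoI)
    fix e :: real assume "e > 0"
    then obtain k where k: "k > 0" "um k < m + e / 2"
      using cINF_less_iff[OF _ bdd, of "m + e / 2"] unfolding m_def by auto
    have near: "um L < m + e" if L: "L > 0" "L \<ge> 2 * um k * k / e + 1" for L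
    proof -
      have "mean_le L h (um k * (1 + k / L))"
      proof (rule mean_leI)
        fix \<xi>
        have "(LINT t:{\<xi>..\<xi> + L}|lebesgue. h t) \<le> um k * (L + k)"
          by (rule mean_le_long_window[OF h _ k(1) L(1) um0[OF k(1)]])
            (use um_le[OF k(1)] in auto)
        also have "\<dots> = um k * (1 + k / L) * L"
          using L by (simp add: field_simps)
        finally show "(LINT t:{\<xi>..\<xi> + L}|lebesgue. h t) \<le> um k * (1 + k / L) * L" .
      qed
      then have "um L \<le> um k + um k * k / L"
        using um_le[OF L(1)] by (simp add: algebra_simps)
      moreover have "2 * um k * k / e < L" using L by linarith
      then have "um k * k / L < e / 2"
        using L \<open>e > 0\<close> by (simp add: field_simps)
      ultimately show ?thesis using k by linarith
    qed
    have "dist (um L) m < e" if "max 1 (2 * um k * k / e + 1) \<le> L" for L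
      using that near[of L] m_le[of L] \<open>e > 0\<close> by (simp add: dist_real_def)
    then show "\<forall>\<^sub>F L in at_top. dist (um L) m < e"
      by (rule eventually_at_top_linorderI)
  qed
  then have "Lim at_top um = m"
    by (intro tendsto_Lim) auto
  moreover have "\<bar>h t\<bar> = h t" for t using unit_funD[OF h] by simp
  then have "Weyl_norm h = Lim at_top um"
    unfolding Weyl_norm_def um_def by simp
  ultimately have "Weyl_norm h = m" by simp
  then show "0 \<le> Weyl_norm h" "Weyl_norm h \<le> c"
    using m0 m_le[OF l] um_le[OF l] bound by auto
qed

section \<open>Almost periodicity in terms of window means\<close>

abbreviation displacement :: "(real \<Rightarrow> 'a::metric_space) \<Rightarrow> real \<Rightarrow> real \<Rightarrow> real" where
  "displacement f \<tau> \<equiv> \<lambda>t. min 1 (dist (f t) (f (t + \<tau>)))"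

lemma unit_fun_displacement:
  "countably_approximable f \<Longrightarrow> unit_fun (displacement f \<tau>)"
  by (intro unit_fun_min_dist countably_approximable_shift)

lemma displacement_mean_le_iff:
  assumes "countably_approximable f" "l > 0"
  shows "Weyl_D l f (\<lambda>t. f (t + \<tau>)) \<le> c \<longleftrightarrow> mean_le l (displacement f \<tau>) c"
  using assms by (intro Weyl_D_le_iff countably_approximable_shift)

lemma relatively_dense_mono:
  "relatively_dense A \<Longrightarrow> A \<subseteq> B \<Longrightarrow> relatively_dense B"
  unfolding relatively_dense_def by blast

lemma Weyl_ap_approximable: "f \<in> Weyl_ap \<Longrightarrow> countably_approximable f"
  by (auto simp: Weyl_ap_def intro: M_class_countably_approximable)

lemma Weyl_apD:
  assumes "f \<in> Weyl_ap" "e > 0"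
  shows "\<exists>l>0. relatively_dense {\<tau>. mean_le l (displacement f \<tau>) e}"
proof -
  have f: "countably_approximable f"
    using assms(1) by (rule Weyl_ap_approximable)
  obtain l where l: "l > 0" "relatively_dense {\<tau>. Weyl_D l f (\<lambda>t. f (t + \<tau>)) < e}"
    using assms by (auto simp: Weyl_ap_def)
  have "{\<tau>. Weyl_D l f (\<lambda>t. f (t + \<tau>)) < e} \<subseteq> {\<tau>. mean_le l (displacement f \<tau>) e}"
    using displacement_mean_le_iff[OF f l(1)] by (auto dest: less_imp_le)
  with l show ?thesis by (blast intro: relatively_dense_mono)
qed

lemma Weyl_apI:
  assumes "f \<in> M_class"
    and ap: "\<And>e. e > 0 \<Longrightarrow> \<exists>l>0. relatively_dense {\<tau>. mean_le l (displacement f \<tau>) e}"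
  shows "f \<in> Weyl_ap"
  unfolding Weyl_ap_def
proof (intro CollectI conjI allI impI assms(1))
  fix e :: real assume "e > 0"
  then obtain l where l: "l > 0" "relatively_dense {\<tau>. mean_le l (displacement f \<tau>) (e / 2)}"
    using ap[of "e / 2"] by auto
  have "{\<tau>. mean_le l (displacement f \<tau>) (e / 2)} \<subseteq> {\<tau>. Weyl_D l f (\<lambda>t. f (t + \<tau>)) < e}"
    using displacement_mean_le_iff[OF M_class_countably_approximable[OF assms(1)] l(1), of _ "e / 2"]
      \<open>e > 0\<close> by force
  with l show "\<exists>l>0. relatively_dense {\<tau>. Weyl_D l f (\<lambda>t. f (t + \<tau>)) < e}"
    by (blast intro: relatively_dense_mono)
qed

lemma returning_iff:
  assumes f: "countably_approximable f"
  shows "returning f \<tau> \<longleftrightarrow>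
    (\<forall>e>0. \<exists>l>0. \<exists>j0. \<forall>j\<ge>j0. mean_le l (displacement f (\<tau> j)) e)"
proof
  assume "returning f \<tau>"
  then show "\<forall>e>0. \<exists>l>0. \<exists>j0. \<forall>j\<ge>j0. mean_le l (displacement f (\<tau> j)) e"
    unfolding returning_def using displacement_mean_le_iff[OF f] by (meson less_imp_le)
next
  assume r: "\<forall>e>0. \<exists>l>0. \<exists>j0. \<forall>j\<ge>j0. mean_le l (displacement f (\<tau> j)) e"
  show "returning f \<tau>"
    unfolding returning_def
  proof (intro allI impI)
    fix e :: real assume "e > 0"
    then obtain l j0 where "l > 0" "\<forall>j\<ge>j0. mean_le l (displacement f (\<tau> j)) (e / 2)"
      using r half_gt_zero by blast
    then have "\<forall>j\<ge>j0. Weyl_D l f (\<lambda>t. f (t + \<tau> j)) < e"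
      using displacement_mean_le_iff[OF f, of l _ "e / 2"] \<open>e > 0\<close> by force
    with \<open>l > 0\<close> show "\<exists>l>0. \<exists>j0. \<forall>j\<ge>j0. Weyl_D l f (\<lambda>t. f (t + \<tau> j)) < e"
      by blast
  qed
qed

text \<open>
  An almost period of \<open>h\<close> in the interval of length \<open>a\<close> that starts at \<open>- \<xi>\<close> moves the window starting at
  \<open>\<xi>\<close> onto one starting between \<open>0\<close> and \<open>a\<close>, which for \<open>L\<close> much larger than \<open>a\<close> is almost the
  window starting at \<open>0\<close>. So all long windows see nearly the same average.
\<close>

lemma uniform_mean:
  assumes h: "unit_fun h"
    and ap: "\<And>e. e > 0 \<Longrightarrow> \<exists>l>0. relatively_dense {\<tau>. mean_le l (\<lambda>t. \<bar>h t - h (t + \<tau>)\<bar>) e}"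
    and e: "e > 0"
  shows "\<exists>L0>0. \<forall>L\<ge>L0. \<forall>\<xi>.
    (LINT t:{\<xi>..\<xi> + L}|lebesgue. h t) \<le> (LINT t:{0..L}|lebesgue. h t) + e * L"
proof -
  obtain l where l: "l > 0" "relatively_dense {\<tau>. mean_le l (\<lambda>t. \<bar>h t - h (t + \<tau>)\<bar>) (e / 3)}"
    using ap[of "e / 3"] e by auto
  then obtain a where a: "a > 0"
    "\<And>\<xi>. {\<xi>..\<xi> + a} \<inter> {\<tau>. mean_le l (\<lambda>t. \<bar>h t - h (t + \<tau>)\<bar>) (e / 3)} \<noteq> {}"
    unfolding relatively_dense_def by blast
  have "(LINT t:{\<xi>..\<xi> + L}|lebesgue. h t) \<le> (LINT t:{0..L}|lebesgue. h t) + e * L"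
    if L: "L \<ge> l" "L \<ge> 3 * a / e" for L \<xi>
  proof -
    obtain \<tau> where \<tau>: "- \<xi> \<le> \<tau>" "\<tau> \<le> - \<xi> + a"
      and m: "mean_le l (\<lambda>t. \<bar>h t - h (t + \<tau>)\<bar>) (e / 3)"
      using a(2)[of "- \<xi>"] by auto
    note h\<tau> = unit_fun_shift[OF h, of \<tau>]
    note d = unit_fun_abs_diff[OF h h\<tau>]
    have "(LINT t:{\<xi>..\<xi> + L}|lebesgue. h t) \<le> (LINT t:{\<xi>..\<xi> + L}|lebesgue. h (t + \<tau>)) +
        1 * (LINT t:{\<xi>..\<xi> + L}|lebesgue. \<bar>h t - h (t + \<tau>)\<bar>)"
      by (rule window_integral_le[OF h _ h\<tau> d]) auto
    moreover have "(LINT t:{\<xi>..\<xi> + L}|lebesgue. h (t + \<tau>)) \<le>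
        (LINT t:{0..L}|lebesgue. h t) + (LINT t:{L..L + a}|lebesgue. h t)"
      unfolding window_integral_shift[OF h]
      by (rule window_integral_subadditive[OF h]) (use \<tau> in auto)
    moreover have "(LINT t:{L..L + a}|lebesgue. h t) \<le> a"
      using window_integral_bounds(2)[OF h, of L "L + a"] a by simp
    moreover have "a \<le> e / 3 * L"
      using L(2) e by (simp add: field_simps)
    moreover have "(LINT t:{\<xi>..\<xi> + L}|lebesgue. \<bar>h t - h (t + \<tau>)\<bar>) \<le> 2 * (e / 3) * L"
      by (rule mean_leD[OF mean_le_larger_scale[OF d m l(1) L(1)]]) (use e in simp)
    ultimately show ?thesis by simp
  qed
  then show ?thesis
    using l(1) by (intro exI[of _ "max l (3 * a / e)"]) auto
qed

section \<open>Radii whose spheres are rarely approached\<close>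

definition thin_shell :: "(real \<Rightarrow> 'a::metric_space) \<Rightarrow> 'a \<Rightarrow> real \<Rightarrow> real \<Rightarrow> bool" where
  "thin_shell f x r c \<longleftrightarrow>
    (\<exists>\<delta>>0. \<exists>l>0. mean_le l (indicator {t. \<bar>dist (f t) x - r\<bar> < \<delta>}) c)"

lemma level_measurable:
  assumes "countably_approximable f"
  shows "(\<lambda>t. dist (f t) x) \<in> borel_measurable lebesgue"
  using dist_measurable[OF assms countably_approximable_const] .

lemma level_lipschitz: "\<bar>dist p x - dist q x\<bar> \<le> dist p q"
  using abs_dist_diff_le[of p x q] by (simp add: dist_commute)

lemma shell_measurable:
  assumes "countably_approximable f"
  shows "{t. \<bar>dist (f t) x - r\<bar> < \<delta>} \<in> sets lebesgue"
proof -
  have [measurable]: "(\<lambda>t. dist (f t) x) \<in> borel_measurable lebesgue"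
    by (rule level_measurable[OF assms])
  have "{t \<in> space lebesgue. \<bar>dist (f t) x - r\<bar> < \<delta>} \<in> sets lebesgue" by measurable
  then show ?thesis by simp
qed

lemma finite_set_separation:
  assumes "finite (R :: real set)"
  shows "\<exists>d>0. \<forall>r\<in>R. \<forall>s\<in>R. r \<noteq> s \<longrightarrow> d \<le> \<bar>r - s\<bar>"
proof -
  define D where "D = insert 1 ((\<lambda>(r, s). \<bar>r - s\<bar>) ` {(r, s) \<in> R \<times> R. r \<noteq> s})"
  have D: "finite D"
  proof -
    have "finite {(r, s) \<in> R \<times> R. r \<noteq> s}"
      by (rule finite_subset[of _ "R \<times> R"]) (use assms in auto)
    then show ?thesis unfolding D_def by simp
  qed
  have "Min D > 0"
    using D by (subst Min_gr_iff) (auto simp: D_def)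
  moreover have "Min D \<le> \<bar>r - s\<bar>" if "r \<in> R" "s \<in> R" "r \<noteq> s" for r s
    using that D by (intro Min_le) (auto simp: D_def)
  ultimately show ?thesis by blast
qed

text \<open>
  The function that is \<open>1\<close> on the \<open>\<delta>\<close>-neighbourhood of \<open>r\<close>, vanishes off its
  \<open>2 * \<delta>\<close>-neighbourhood, and is affine in between.
\<close>

definition tent :: "real \<Rightarrow> real \<Rightarrow> real \<Rightarrow> real" where
  "tent \<delta> r s = max 0 (min 1 (2 - \<bar>s - r\<bar> / \<delta>))"

lemma tent_lipschitz:
  assumes "0 < \<delta>" "\<delta> \<le> 1"
  shows "\<bar>tent \<delta> r s - tent \<delta> r u\<bar> \<le> (1 / \<delta>) * min 1 \<bar>s - u\<bar>"
proof -
  have "\<bar>tent \<delta> r s - tent \<delta> r u\<bar> \<le> \<bar>\<bar>s - r\<bar> / \<delta> - \<bar>u - r\<bar> / \<delta>\<bar>"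
    unfolding tent_def by linarith
  also have "\<dots> = \<bar>\<bar>s - r\<bar> - \<bar>u - r\<bar>\<bar> / \<delta>"
    using assms by (simp add: diff_divide_distrib[symmetric])
  also have "\<dots> \<le> \<bar>s - u\<bar> / \<delta>"
    using assms by (intro divide_right_mono) auto
  finally have "\<bar>tent \<delta> r s - tent \<delta> r u\<bar> \<le> \<bar>s - u\<bar> / \<delta>" .
  moreover have "\<bar>tent \<delta> r s - tent \<delta> r u\<bar> \<le> 1"
    unfolding tent_def by linarith
  moreover have "1 \<le> 1 / \<delta>" using assms by simp
  ultimately show ?thesis by (auto simp: min_def)
qed

text \<open>
  If too many radii had thick shells, then the tents around them, separated from each other, would
  have means adding up to more than \<open>1\<close>. Upper means over windows are only subadditive; the
  addition is legitimate because the tents composed with the distance are almost periodic, so that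
  their averages can all be read off the one window \<open>{0..L}\<close>.
\<close>

lemma finite_thick_radii:
  assumes f: "f \<in> Weyl_ap" and c: "c > 0"
  shows "finite {r. \<not> thin_shell f x r c}"
proof (rule ccontr)
  assume "infinite {r. \<not> thin_shell f x r c}"
  then obtain R where R: "R \<subseteq> {r. \<not> thin_shell f x r c}" "finite R"
    "card R = Suc (nat \<lceil>2 / c\<rceil>)"
    using infinite_arbitrarily_large by blast
  have ca: "countably_approximable f"
    using f by (rule Weyl_ap_approximable)
  obtain d where d: "d > 0" "\<And>r s. r \<in> R \<Longrightarrow> s \<in> R \<Longrightarrow> r \<noteq> s \<Longrightarrow> d \<le> \<bar>r - s\<bar>"
    using finite_set_separation[OF R(2)] by blast
  \<comment> \<open>Tents of half-width \<open>2 * \<delta> \<le> d / 2\<close> around different radii do not overlap.\<close>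
  define \<delta> where "\<delta> = min 1 (d / 4)"
  have \<delta>: "0 < \<delta>" "\<delta> \<le> 1" "4 * \<delta> \<le> d"
    using d(1) by (auto simp: \<delta>_def)
  define h where "h r t = tent \<delta> r (dist (f t) x)" for r t
  have h: "unit_fun (h r)" for r
  proof -
    have [measurable]: "(\<lambda>t. dist (f t) x) \<in> borel_measurable lebesgue"
      by (rule level_measurable[OF ca])
    have "h r \<in> borel_measurable lebesgue"
      unfolding h_def[abs_def] tent_def by measurable
    then show ?thesis by (auto simp: unit_fun_def h_def tent_def)
  qed
  have sum_h: "(\<Sum>r\<in>R. h r t) \<le> 1" for t
  proof (cases "\<exists>r\<in>R. h r t \<noteq> 0")
    case True
    then obtain r where r: "r \<in> R" "h r t \<noteq> 0" by blast
    have near: "\<bar>dist (f t) x - s\<bar> < 2 * \<delta>" if "h s t \<noteq> 0" for s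
      using that \<delta>(1) by (auto simp: h_def tent_def max_def min_def field_simps split: if_splits)
    have "h s t = 0" if "s \<in> R" "s \<noteq> r" for s
      using near[of s] near[OF r(2)] d(2)[OF that(1) r(1) that(2)] \<delta>(3) by linarith
    then have "(\<Sum>s\<in>R - {r}. h s t) = 0" by (intro sum.neutral) auto
    then have "(\<Sum>s\<in>R. h s t) = h r t"
      using sum.remove[OF R(2) r(1), of "\<lambda>s. h s t"] by simp
    then show ?thesis using unit_funD(3)[OF h] by simp
  next
    case False
    then show ?thesis by simp
  qed
  have mean: "\<exists>L0>0. \<forall>L\<ge>L0. \<forall>\<xi>.
      (LINT t:{\<xi>..\<xi> + L}|lebesgue. h r t) \<le> (LINT t:{0..L}|lebesgue. h r t) + (c / 2) * L" for r
  proof (rule uniform_mean[OF h])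
    fix e :: real assume "e > 0"
    then obtain l where l: "l > 0" "relatively_dense {\<tau>. mean_le l (displacement f \<tau>) (\<delta> * e)}"
      using Weyl_apD[OF f, of "\<delta> * e"] \<delta>(1) by auto
    have "mean_le l (\<lambda>t. \<bar>h r t - h r (t + \<tau>)\<bar>) e"
      if "mean_le l (displacement f \<tau>) (\<delta> * e)" for \<tau>
    proof -
      have "\<bar>h r t - h r (t + \<tau>)\<bar> \<le> 0 + (1 / \<delta>) * displacement f \<tau> t" for t
      proof -
        have "\<bar>h r t - h r (t + \<tau>)\<bar> \<le> (1 / \<delta>) * min 1 \<bar>dist (f t) x - dist (f (t + \<tau>)) x\<bar>"
          unfolding h_def by (rule tent_lipschitz) (use \<delta> in auto)
        also have "\<bar>dist (f t) x - dist (f (t + \<tau>)) x\<bar> \<le> dist (f t) (f (t + \<tau>))"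
          by (rule level_lipschitz)
        finally show ?thesis using \<delta>(1) by (simp add: divide_right_mono)
      qed
      then have "mean_le l (\<lambda>t. \<bar>h r t - h r (t + \<tau>)\<bar>) (0 + (1 / \<delta>) * (\<delta> * e))"
        by (rule mean_le_combine[OF unit_fun_abs_diff[OF h unit_fun_shift[OF h]] _ _
              unit_fun_displacement[OF ca] _ that])
          (use \<delta>(1) in \<open>auto simp: unit_fun_def mean_le_def set_lebesgue_integral_def\<close>)
      then show ?thesis using \<delta>(1) by simp
    qed
    with l show "\<exists>l>0. relatively_dense {\<tau>. mean_le l (\<lambda>t. \<bar>h r t - h r (t + \<tau>)\<bar>) e}"
      by (blast intro: relatively_dense_mono)
  qed (use c in simp)
  obtain L0 where L0: "\<forall>r. L0 r > 0 \<and> (\<forall>L\<ge>L0 r. \<forall>\<xi>.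
      (LINT t:{\<xi>..\<xi> + L}|lebesgue. h r t) \<le> (LINT t:{0..L}|lebesgue. h r t) + (c / 2) * L)"
    using choice[OF allI[OF mean]] by (rule exE)
  define L where "L = Max (insert 1 (L0 ` R))"
  have L: "L > 0" "\<And>r. r \<in> R \<Longrightarrow> L0 r \<le> L"
    unfolding L_def using R(2) by (auto simp: Max_ge_iff Max_gr_iff)
  have large: "(c / 2) * L < (LINT t:{0..L}|lebesgue. h r t)" if r: "r \<in> R" for r
  proof -
    define S where "S = {t. \<bar>dist (f t) x - r\<bar> < \<delta>}"
    have S: "unit_fun (indicator S)"
      unfolding S_def by (intro unit_fun_indicator shell_measurable ca)
    have "\<not> mean_le L (indicator S) c"
      using R(1) r \<delta>(1) L(1) unfolding thin_shell_def S_def by blast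
    then obtain \<xi> where "c * L < (LINT t:{\<xi>..\<xi> + L}|lebesgue. indicator S t)"
      by (auto simp: mean_le_def not_le)
    also have "\<dots> \<le> (LINT t:{\<xi>..\<xi> + L}|lebesgue. h r t) + 0 * (LINT t:{\<xi>..\<xi> + L}|lebesgue. h r t)"
    proof (rule window_integral_le[OF S _ h h])
      fix t
      show "indicator S t \<le> h r t + 0 * h r t"
      proof (cases "t \<in> S")
        case True
        then have "\<bar>dist (f t) x - r\<bar> / \<delta> \<le> 1"
          using \<delta>(1) by (auto simp: S_def)
        then show ?thesis by (simp add: h_def tent_def)
      qed (use unit_funD(2)[OF h] in simp)
    qed
    also have "\<dots> \<le> (LINT t:{0..L}|lebesgue. h r t) + (c / 2) * L"
      using L0 L(2)[OF r] by simp
    finally show ?thesis by (simp add: algebra_simps)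
  qed
  have H: "unit_fun (\<lambda>t. \<Sum>r\<in>R. h r t)"
    using sum_h unit_funD[OF h] by (auto simp: unit_fun_def intro!: sum_nonneg)
  have "real (card R) * ((c / 2) * L) \<le> (\<Sum>r\<in>R. LINT t:{0..L}|lebesgue. h r t)"
    using sum_bounded_below[of R "(c / 2) * L" "\<lambda>r. LINT t:{0..L}|lebesgue. h r t"] large
    by (simp add: less_imp_le)
  also have "\<dots> = (LINT t:{0..L}|lebesgue. (\<Sum>r\<in>R. h r t))"
    unfolding set_lebesgue_integral_def
    using unit_fun_set_integrable[OF h, unfolded set_integrable_def]
    by (subst Bochner_Integration.integral_sum[symmetric]) (auto simp: sum_distrib_left)
  also have "\<dots> \<le> L"
    using window_integral_bounds(2)[OF H, of 0 L] L(1) by simp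
  finally have "real (card R) * (c / 2) \<le> 1"
    using L(1) by simp
  then have "real (card R) \<le> 2 / c"
    using c by (simp add: field_simps)
  then show False
    unfolding R(3) by linarith
qed

text \<open>
  For each \<open>c = 1 / (n + 1)\<close> only finitely many radii fail, and an interval is uncountable.
\<close>

lemma thin_shell_radius_exists:
  assumes f: "f \<in> Weyl_ap" and "a < b"
  shows "\<exists>r. a < r \<and> r < b \<and> (\<forall>c>0. thin_shell f x r c)"
proof (rule ccontr)
  assume none: "\<nexists>r. a < r \<and> r < b \<and> (\<forall>c>0. thin_shell f x r c)"
  have "{a<..<b} \<subseteq> (\<Union>n. {r. \<not> thin_shell f x r (inverse (real (Suc n)))})"
  proof
    fix r assume "r \<in> {a<..<b}"
    then obtain c where c: "c > 0" "\<not> thin_shell f x r c"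
      using none by auto
    obtain n where n: "inverse (real (Suc n)) < c"
      using reals_Archimedean[OF c(1)] by blast
    have "\<not> thin_shell f x r (inverse (real (Suc n)))"
    proof
      assume "thin_shell f x r (inverse (real (Suc n)))"
      then obtain \<delta> l where *: "\<delta> > 0" "l > 0"
        "mean_le l (indicator {t. \<bar>dist (f t) x - r\<bar> < \<delta>}) (inverse (real (Suc n)))"
        unfolding thin_shell_def by blast
      then have "mean_le l (indicator {t. \<bar>dist (f t) x - r\<bar> < \<delta>}) c"
        using n by (intro mean_le_mono_bound[OF *(3)]) auto
      with * c show False unfolding thin_shell_def by blast
    qed
    then show "r \<in> (\<Union>n. {r. \<not> thin_shell f x r (inverse (real (Suc n)))})" by blast
  qed
  moreover have "countable (\<Union>n. {r. \<not> thin_shell f x r (inverse (real (Suc n)))})"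
    by (intro countable_UN[OF countableI_type] countable_finite finite_thick_radii[OF f]) simp
  ultimately show False
    using uncountable_open_interval[of a b] \<open>a < b\<close> countable_subset by blast
qed

section \<open>Sets moved little by the almost periods of a function\<close>

text \<open>
  The order of quantifiers matters. Having the conclusion at all large scales \<open>L\<close>, and not just at
  one, makes it possible to combine two sets; a threshold \<open>L0\<close> that depends on \<open>l\<close> but not on \<open>\<tau>\<close>
  makes it possible to treat a relatively dense set or a sequence of translations at a single scale.
\<close>

definition displacement_transfer ::
    "(real \<Rightarrow> 'a::metric_space) \<Rightarrow> real set \<Rightarrow> real \<Rightarrow> real \<Rightarrow> bool" where
  "displacement_transfer f S \<delta> e \<longleftrightarrow>
    (\<forall>l>0. \<exists>L0>0. \<forall>L\<ge>L0. \<forall>\<tau>. mean_le l (displacement f \<tau>) \<delta> \<longrightarrow>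
      mean_le L (displacement (indicator S :: real \<Rightarrow> real) \<tau>) e)"

definition translation_controlled :: "(real \<Rightarrow> 'a::metric_space) \<Rightarrow> real set \<Rightarrow> bool" where
  "translation_controlled f S \<longleftrightarrow>
    S \<in> sets lebesgue \<and> (\<forall>e>0. \<exists>\<delta>>0. displacement_transfer f S \<delta> e)"

lemma displacement_transferE:
  assumes "displacement_transfer f S \<delta> e" "l > 0"
  obtains L0 where "L0 > 0"
    "\<And>L \<tau>. L0 \<le> L \<Longrightarrow> mean_le l (displacement f \<tau>) \<delta> \<Longrightarrow>
      mean_le L (displacement (indicator S :: real \<Rightarrow> real) \<tau>) e"
proof -
  obtain L0 where L0: "L0 > 0" "\<forall>L\<ge>L0. \<forall>\<tau>. mean_le l (displacement f \<tau>) \<delta> \<longrightarrow>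
      mean_le L (displacement (indicator S :: real \<Rightarrow> real) \<tau>) e"
    using assms(1)[unfolded displacement_transfer_def, THEN spec, THEN mp, OF assms(2)]
    by (elim exE conjE) (rule that)
  show thesis
    by (rule that[OF L0(1)]) (use L0(2)[THEN spec, THEN mp, THEN spec, THEN mp] in assumption)
qed

lemma indicator_approximable:
  "S \<in> sets lebesgue \<Longrightarrow> countably_approximable (indicator S :: real \<Rightarrow> real)"
  by (intro M_class_countably_approximable indicator_M_class)

text \<open>
  The module is defined by returning sequences, and it is antitone in the set of these: a set moved
  little whenever \<open>f\<close> is moved little has at least the returning sequences of \<open>f\<close>.
\<close>

lemma translation_controlled_Weyl_set:
  assumes f: "f \<in> Weyl_ap" and S: "translation_controlled f S"
  shows "S \<in> Weyl_sets" "Mod_set S \<subseteq> Mod_fun f"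
proof -
  have Sm: "S \<in> sets lebesgue" using S by (simp add: translation_controlled_def)
  have ca: "countably_approximable f"
    using f by (rule Weyl_ap_approximable)
  have ctrl: "\<exists>\<delta>>0. displacement_transfer f S \<delta> e" if "e > 0" for e
    using S that by (simp add: translation_controlled_def)
  have "(indicator S :: real \<Rightarrow> real) \<in> Weyl_ap"
  proof (rule Weyl_apI[OF indicator_M_class[OF Sm]])
    fix e :: real assume "e > 0"
    then obtain \<delta> where \<delta>: "\<delta> > 0" "displacement_transfer f S \<delta> e"
      using ctrl by blast
    obtain l where l: "l > 0" "relatively_dense {\<tau>. mean_le l (displacement f \<tau>) \<delta>}"
      using Weyl_apD[OF f \<delta>(1)] by blast
    obtain L where L: "L > 0" "\<And>L' \<tau>. L \<le> L' \<Longrightarrow> mean_le l (displacement f \<tau>) \<delta> \<Longrightarrow>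
        mean_le L' (displacement (indicator S :: real \<Rightarrow> real) \<tau>) e"
      using displacement_transferE[OF \<delta>(2) l(1)] by blast
    have "relatively_dense {\<tau>. mean_le L (displacement (indicator S :: real \<Rightarrow> real) \<tau>) e}"
      by (rule relatively_dense_mono[OF l(2)]) (use L(2) in auto)
    with L(1) show "\<exists>L>0. relatively_dense
        {\<tau>. mean_le L (displacement (indicator S :: real \<Rightarrow> real) \<tau>) e}"
      by (intro exI[of _ L] conjI)
  qed
  then show "S \<in> Weyl_sets" using Sm by (simp add: Weyl_sets_def)
  have "returning (indicator S :: real \<Rightarrow> real) \<tau>" if ret: "returning f \<tau>" for \<tau>
    unfolding returning_iff[OF indicator_approximable[OF Sm]]
  proof (intro allI impI)
    fix e :: real assume "e > 0"
    then obtain \<delta> where \<delta>: "\<delta> > 0" "displacement_transfer f S \<delta> e"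
      using ctrl by blast
    obtain l j0 where l: "l > 0" "\<And>j. j \<ge> j0 \<Longrightarrow> mean_le l (displacement f (\<tau> j)) \<delta>"
      using ret \<delta>(1) unfolding returning_iff[OF ca] by blast
    obtain L where L: "L > 0" "\<And>L' \<tau>. L \<le> L' \<Longrightarrow> mean_le l (displacement f \<tau>) \<delta> \<Longrightarrow>
        mean_le L' (displacement (indicator S :: real \<Rightarrow> real) \<tau>) e"
      using displacement_transferE[OF \<delta>(2) l(1)] by blast
    show "\<exists>L>0. \<exists>j0. \<forall>j\<ge>j0. mean_le L (displacement (indicator S :: real \<Rightarrow> real) (\<tau> j)) e"
      by (intro exI[of _ L] conjI exI[of _ j0] allI impI L l order_refl)
  qed
  then show "Mod_set S \<subseteq> Mod_fun f"
    unfolding Mod_set_def Mod_fun_def by blast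
qed

text \<open>
  The hypothesis on \<open>C\<close> says that membership in \<open>C\<close> is a Boolean function of membership in \<open>A\<close> and
  in \<open>B\<close>. Where a translation changes the former, it changes
  one of the latter.
\<close>

lemma translation_controlled_combine:
  assumes A: "translation_controlled f A" and B: "translation_controlled f B"
    and C: "C \<in> sets lebesgue"
    and bool: "\<And>t u. (t \<in> A \<longleftrightarrow> u \<in> A) \<Longrightarrow> (t \<in> B \<longleftrightarrow> u \<in> B) \<Longrightarrow> (t \<in> C \<longleftrightarrow> u \<in> C)"
  shows "translation_controlled f C"
  unfolding translation_controlled_def
proof (intro conjI C allI impI)
  fix e :: real assume "e > 0"
  then have e2: "e / 2 > 0" by simp
  have unit: "unit_fun (displacement (indicator S :: real \<Rightarrow> real) \<tau>)" if "S \<in> sets lebesgue" for S \<tau>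
    using that by (intro unit_fun_displacement indicator_approximable)
  have meas: "A \<in> sets lebesgue" "B \<in> sets lebesgue"
    using A B by (auto simp: translation_controlled_def)
  obtain \<delta>1 where \<delta>1: "\<delta>1 > 0" "displacement_transfer f A \<delta>1 (e / 2)"
    using A e2 unfolding translation_controlled_def by blast
  obtain \<delta>2 where \<delta>2: "\<delta>2 > 0" "displacement_transfer f B \<delta>2 (e / 2)"
    using B e2 unfolding translation_controlled_def by blast
  have "displacement_transfer f C (min \<delta>1 \<delta>2) e"
    unfolding displacement_transfer_def
  proof (intro allI impI)
    fix l :: real assume l: "l > 0"
    obtain L1 where L1: "L1 > 0" "\<And>L \<tau>. L1 \<le> L \<Longrightarrow> mean_le l (displacement f \<tau>) \<delta>1 \<Longrightarrow>
        mean_le L (displacement (indicator A :: real \<Rightarrow> real) \<tau>) (e / 2)"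
      using displacement_transferE[OF \<delta>1(2) l] by blast
    obtain L2 where L2: "L2 > 0" "\<And>L \<tau>. L2 \<le> L \<Longrightarrow> mean_le l (displacement f \<tau>) \<delta>2 \<Longrightarrow>
        mean_le L (displacement (indicator B :: real \<Rightarrow> real) \<tau>) (e / 2)"
      using displacement_transferE[OF \<delta>2(2) l] by blast
    show "\<exists>L0>0. \<forall>L\<ge>L0. \<forall>\<tau>. mean_le l (displacement f \<tau>) (min \<delta>1 \<delta>2) \<longrightarrow>
        mean_le L (displacement (indicator C :: real \<Rightarrow> real) \<tau>) e"
    proof (intro exI[of _ "max L1 L2"] conjI allI impI)
      fix L \<tau> assume L: "max L1 L2 \<le> L" and m: "mean_le l (displacement f \<tau>) (min \<delta>1 \<delta>2)"
      have "mean_le l (displacement f \<tau>) \<delta>1" "mean_le l (displacement f \<tau>) \<delta>2"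
        using mean_le_mono_bound[OF m] l by auto
      then have AB: "mean_le L (displacement (indicator A :: real \<Rightarrow> real) \<tau>) (e / 2)"
        "mean_le L (displacement (indicator B :: real \<Rightarrow> real) \<tau>) (e / 2)"
        using L1(2) L2(2) L by auto
      have "displacement (indicator C :: real \<Rightarrow> real) \<tau> t \<le>
          displacement (indicator A :: real \<Rightarrow> real) \<tau> t +
          1 * displacement (indicator B :: real \<Rightarrow> real) \<tau> t" for t
        using bool[of t "t + \<tau>"] by (auto simp: indicator_def)
      then have "mean_le L (displacement (indicator C :: real \<Rightarrow> real) \<tau>) (e / 2 + 1 * (e / 2))"
        by (rule mean_le_combine[OF unit[OF C] _ unit[OF meas(1)] unit[OF meas(2)] AB]) simp
      then show "mean_le L (displacement (indicator C :: real \<Rightarrow> real) \<tau>) e" by simp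
    qed (use L1 in auto)
  qed
  then show "\<exists>\<delta>>0. displacement_transfer f C \<delta> e"
    using \<delta>1(1) \<delta>2(1) by (intro exI[of _ "min \<delta>1 \<delta>2"]) simp
qed

lemma translation_controlled_empty: "translation_controlled f {}"
  unfolding translation_controlled_def displacement_transfer_def
  by (auto intro!: exI[of _ 1] simp: mean_le_def set_lebesgue_integral_def)

lemma translation_controlled_disjointed:
  assumes B: "\<And>j. translation_controlled f (B j)"
  shows "translation_controlled f (disjointed B n)"
proof -
  have meas: "B j \<in> sets lebesgue" for j
    using B by (simp add: translation_controlled_def)
  have U: "translation_controlled f (\<Union>i\<in>{0..<n}. B i)" for n
  proof (induction n)
    case 0
    then show ?case by (simp add: translation_controlled_empty)
  next
    case (Suc n)
    show ?case
      by (rule translation_controlled_combine[OF Suc B[of n]])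
        (use meas in \<open>auto simp: atLeastLessThanSuc intro!: sets.finite_UN\<close>)
  qed
  show ?thesis
    unfolding disjointed_def
    by (rule translation_controlled_combine[OF B[of n] U[of n]]) (use meas in auto)
qed

text \<open>
  If \<open>t\<close> and \<open>t + \<tau>\<close> lie on different sides of the level \<open>r\<close>, then either \<open>t\<close> lies in the shell, which
  is rare, or \<open>f\<close> is displaced by at least the thickness of the shell, which is rare when the mean
  displacement is small compared with that thickness.
\<close>

lemma translation_controlled_ball:
  assumes ca: "countably_approximable f" and thin: "\<And>c. c > 0 \<Longrightarrow> thin_shell f x r c"
  shows "translation_controlled f {t. dist (f t) x < r}"
  unfolding translation_controlled_def
proof (intro conjI allI impI)
  define S where "S = {t. dist (f t) x < r}"
  have [measurable]: "(\<lambda>t. dist (f t) x) \<in> borel_measurable lebesgue"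
    by (rule level_measurable[OF ca])
  have "{t \<in> space lebesgue. dist (f t) x < r} \<in> sets lebesgue" by measurable
  then show S: "{t. dist (f t) x < r} \<in> sets lebesgue" by simp
  fix e :: real assume e: "e > 0"
  obtain \<delta> l0 where \<delta>: "\<delta> > 0" and l0: "l0 > 0"
    and band: "mean_le l0 (indicator {t. \<bar>dist (f t) x - r\<bar> < \<delta>}) (e / 4)"
    using thin[of "e / 4"] e unfolding thin_shell_def by auto
  define \<kappa> where "\<kappa> = min 1 \<delta>"
  have \<kappa>: "0 < \<kappa>" "\<kappa> \<le> 1" "\<kappa> \<le> \<delta>" using \<delta> by (auto simp: \<kappa>_def)
  define K where "K = {t. \<bar>dist (f t) x - r\<bar> < \<delta>}"
  have K: "unit_fun (indicator K)"
    unfolding K_def by (intro unit_fun_indicator shell_measurable ca)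
  note band = band[folded K_def]
  have "displacement_transfer f S (\<kappa> * (e / 4)) e"
    unfolding displacement_transfer_def
  proof (intro allI impI)
    fix l :: real assume l: "l > 0"
    show "\<exists>L0>0. \<forall>L\<ge>L0. \<forall>\<tau>. mean_le l (displacement f \<tau>) (\<kappa> * (e / 4)) \<longrightarrow>
        mean_le L (displacement (indicator S :: real \<Rightarrow> real) \<tau>) e"
    proof (intro exI[of _ "max l l0"] conjI allI impI)
      fix L \<tau> assume L: "max l l0 \<le> L" and m: "mean_le l (displacement f \<tau>) (\<kappa> * (e / 4))"
      have "mean_le L (indicator K) (2 * (e / 4))"
        by (rule mean_le_larger_scale[OF K band l0]) (use L e in auto)
      moreover have "mean_le L (displacement f \<tau>) (2 * (\<kappa> * (e / 4)))"
        by (rule mean_le_larger_scale[OF unit_fun_displacement[OF ca] m l]) (use L e \<kappa> in auto)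
      moreover have "displacement (indicator S :: real \<Rightarrow> real) \<tau> t \<le>
          indicator K t + (1 / \<kappa>) * displacement f \<tau> t" for t
      proof (cases "(t \<in> S \<longleftrightarrow> t + \<tau> \<in> S) \<or> t \<in> K")
        case True
        then show ?thesis using \<kappa>(1) by (auto simp: indicator_def)
      next
        case False
        then have "\<delta> \<le> \<bar>dist (f t) x - dist (f (t + \<tau>)) x\<bar>"
          unfolding S_def K_def by auto
        also have "\<dots> \<le> dist (f t) (f (t + \<tau>))"
          by (rule level_lipschitz)
        finally have "\<kappa> \<le> displacement f \<tau> t"
          using \<kappa> by simp
        then have "1 \<le> (1 / \<kappa>) * displacement f \<tau> t"
          using \<kappa>(1) by (simp add: field_simps)
        with False show ?thesis by (simp add: min.coboundedI1)
      qed
      ultimately have "mean_le L (displacement (indicator S :: real \<Rightarrow> real) \<tau>)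
          (2 * (e / 4) + (1 / \<kappa>) * (2 * (\<kappa> * (e / 4))))"
        using S \<kappa>(1) by (intro mean_le_combine[OF _ _ K unit_fun_displacement[OF ca]])
          (auto intro: unit_fun_displacement indicator_approximable simp: S_def)
      then show "mean_le L (displacement (indicator S :: real \<Rightarrow> real) \<tau>) e"
        using \<kappa>(1) by simp
    qed (use l in auto)
  qed
  then show "\<exists>\<delta>>0. displacement_transfer f {t. dist (f t) x < r} \<delta> e"
    unfolding S_def[symmetric] using \<kappa>(1) e by (intro exI[of _ "\<kappa> * (e / 4)"]) simp
qed

section \<open>Uniform exhaustion by countably many balls\<close>

lemma far_from_points_measurable:
  assumes "countably_approximable f"
  shows "{t. \<forall>j\<le>N. s \<le> dist (f t) (x (j::nat))} \<in> sets lebesgue"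
proof -
  have "{t. s \<le> dist (f t) (x j)} \<in> sets lebesgue" for j
  proof -
    have [measurable]: "(\<lambda>t. dist (f t) (x j)) \<in> borel_measurable lebesgue"
      by (rule level_measurable[OF assms])
    have "{t \<in> space lebesgue. s \<le> dist (f t) (x j)} \<in> sets lebesgue" by measurable
    then show ?thesis by simp
  qed
  then have "(\<Inter>j\<in>{..N}. {t. s \<le> dist (f t) (x j)}) \<in> sets lebesgue"
    by (intro sets.finite_INT) auto
  moreover have "(\<Inter>j\<in>{..N}. {t. s \<le> dist (f t) (x j)}) = {t. \<forall>j\<le>N. s \<le> dist (f t) (x j)}"
    by auto
  ultimately show ?thesis by (simp only:)
qed

text \<open>
  This replaces compactness of the range. On the single bounded interval \<open>{0..a + l}\<close> finitely many
  of the balls of radius \<open>s\<close> catch \<open>f\<close> up to small measure. Every window of length \<open>l\<close> is moved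
  into that interval by an almost period, and \<open>f (t + \<tau>)\<close> in a ball of radius \<open>s\<close> forces \<open>f t\<close> into
  the ball of radius \<open>s'\<close> about the same point unless the displacement is at least \<open>s' - s\<close>.
\<close>

lemma uniformly_small_tail:
  assumes f: "f \<in> Weyl_ap" and cover: "AE t in lebesgue. \<exists>j. dist (f t) (x j) < s"
    and "s < s'" and \<eta>: "\<eta> > 0"
  shows "\<exists>l>0. \<exists>N0. \<forall>N\<ge>N0. mean_le l (indicator {t. \<forall>j\<le>N. s' \<le> dist (f t) (x (j::nat))}) \<eta>"
proof -
  have ca: "countably_approximable f"
    using f by (rule Weyl_ap_approximable)
  define C where "C s N = {t. \<forall>j\<le>N. s \<le> dist (f t) (x j)}" for s N
  have C: "C s N \<in> sets lebesgue" for s N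
    unfolding C_def by (rule far_from_points_measurable[OF ca])
  define \<kappa> where "\<kappa> = min 1 (s' - s)"
  have \<kappa>: "0 < \<kappa>" "\<kappa> \<le> 1" "\<kappa> \<le> s' - s" using \<open>s < s'\<close> by (auto simp: \<kappa>_def)
  obtain l where l: "l > 0" "relatively_dense {\<tau>. mean_le l (displacement f \<tau>) (\<kappa> * (\<eta> / 2))}"
    using Weyl_apD[OF f, of "\<kappa> * (\<eta> / 2)"] \<kappa>(1) \<eta> by auto
  then obtain a where a: "a > 0"
    "\<And>\<xi>. {\<xi>..\<xi> + a} \<inter> {\<tau>. mean_le l (displacement f \<tau>) (\<kappa> * (\<eta> / 2))} \<noteq> {}"
    unfolding relatively_dense_def by blast
  have "(\<lambda>N. LINT t:{0..a + l}|lebesgue. indicator (C s N) t) \<longlonglongrightarrow>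
      (LINT t:{0..a + l}|lebesgue. (0::real))"
    unfolding set_lebesgue_integral_def
  proof (rule integral_dominated_convergence)
    show "integrable lebesgue (indicator {0..a + l} :: real \<Rightarrow> real)"
      using set_integrable_one[of 0 "a + l"] by (simp add: set_integrable_def)
    show "AE t in lebesgue. (\<lambda>N. indicator {0..a + l} t *\<^sub>R indicator (C s N) t) \<longlonglongrightarrow>
        indicator {0..a + l} t *\<^sub>R (0::real)"
      using cover
    proof eventually_elim
      case (elim t)
      then obtain j where "dist (f t) (x j) < s" by blast
      then have "t \<notin> C s N" if "N \<ge> j" for N
        using that by (auto simp: C_def not_le intro!: exI[of _ j])
      then have "indicator {0..a + l} t *\<^sub>R indicator (C s N) t = (0::real)" if "N \<ge> j" for N
        using that by simp
      then show ?case
        by (intro tendsto_eventually eventually_sequentiallyI[of j]) simp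
    qed
    show "(\<lambda>t. indicator {0..a + l} t *\<^sub>R indicator (C s N) t :: real) \<in> borel_measurable lebesgue" for N
      using borel_measurable_integrable[OF
          unit_fun_set_integrable[OF unit_fun_indicator[OF C], unfolded set_integrable_def]] .
  qed (auto simp: indicator_def)
  then have "(\<lambda>N. LINT t:{0..a + l}|lebesgue. indicator (C s N) t) \<longlonglongrightarrow> (0::real)"
    by (simp add: set_lebesgue_integral_def)
  then have "\<forall>\<^sub>F N in sequentially. (LINT t:{0..a + l}|lebesgue. indicator (C s N) t) < \<eta> / 2 * l"
    using \<eta> l(1) by (intro order_tendstoD) auto
  then obtain N0 where N0: "\<And>N. N \<ge> N0 \<Longrightarrow>
      (LINT t:{0..a + l}|lebesgue. indicator (C s N) t) < \<eta> / 2 * l"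
    unfolding eventually_sequentially by blast
  have "mean_le l (indicator (C s' N)) \<eta>" if N: "N \<ge> N0" for N
  proof (rule mean_leI)
    fix \<xi>
    obtain \<tau> where \<tau>: "- \<xi> \<le> \<tau>" "\<tau> \<le> - \<xi> + a"
      and m: "mean_le l (displacement f \<tau>) (\<kappa> * (\<eta> / 2))"
      using a(2)[of "- \<xi>"] by auto
    have "(LINT t:{\<xi>..\<xi> + l}|lebesgue. indicator (C s' N) t) \<le>
        (LINT t:{\<xi>..\<xi> + l}|lebesgue. indicator (C s N) (t + \<tau>)) +
        (1 / \<kappa>) * (LINT t:{\<xi>..\<xi> + l}|lebesgue. displacement f \<tau> t)"
    proof (rule window_integral_le)
      fix t
      show "indicator (C s' N) t \<le> indicator (C s N) (t + \<tau>) + (1 / \<kappa>) * displacement f \<tau> t"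
      proof (cases "t \<notin> C s' N \<or> t + \<tau> \<in> C s N")
        case True
        then show ?thesis using \<kappa>(1) by (auto simp: indicator_def)
      next
        case False
        then obtain j where "\<not> s \<le> dist (f (t + \<tau>)) (x j)" "s' \<le> dist (f t) (x j)"
          unfolding C_def by blast
        then have "s' - s \<le> dist (f t) (f (t + \<tau>))"
          using dist_triangle[of "f t" "x j" "f (t + \<tau>)"] by linarith
        then have "\<kappa> \<le> displacement f \<tau> t"
          using \<kappa> by simp
        then have "1 \<le> (1 / \<kappa>) * displacement f \<tau> t"
          using \<kappa>(1) by (simp add: field_simps)
        with False show ?thesis by simp
      qed
    qed (intro unit_fun_indicator unit_fun_shift unit_fun_displacement C ca)+
    also have "(LINT t:{\<xi>..\<xi> + l}|lebesgue. indicator (C s N) (t + \<tau>)) \<le>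
        (LINT t:{0..a + l}|lebesgue. (indicator (C s N) t :: real))"
      unfolding window_integral_shift[OF unit_fun_indicator[OF C]]
      by (rule window_integral_subset[OF unit_fun_indicator[OF C]]) (use \<tau> in auto)
    also have "\<dots> \<le> \<eta> / 2 * l"
      using N0[OF N] by simp
    also have "(1 / \<kappa>) * (LINT t:{\<xi>..\<xi> + l}|lebesgue. displacement f \<tau> t) \<le>
        (1 / \<kappa>) * (\<kappa> * (\<eta> / 2) * l)"
      using mean_leD[OF m] \<kappa>(1) by (intro mult_left_mono) auto
    finally show "(LINT t:{\<xi>..\<xi> + l}|lebesgue. indicator (C s' N) t) \<le> \<eta> * l"
      using \<kappa>(1) by simp
  qed
  then show ?thesis
    using l(1) unfolding C_def by blast
qed

section \<open>The partition\<close>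

theorem theorem1p2:
  fixes f :: "real \<Rightarrow> 'u::complete_space" and \<epsilon> :: real
  assumes "f \<in> Weyl_ap" and "\<epsilon> > 0"
  shows "\<exists>T \<in> Weyl_partitions (Mod_fun f). \<exists>x :: nat \<Rightarrow> 'u.
           \<forall>j. \<forall>t \<in> T j. dist (f t) (x j) < \<epsilon>"
proof -
  note f = assms(1)
  have ca: "countably_approximable f"
    using f by (rule Weyl_ap_approximable)
  obtain x :: "nat \<Rightarrow> 'u" and i where "AE t in lebesgue. dist (f t) (x (i t)) < \<epsilon> / 2"
    using ca half_gt_zero[OF assms(2)] unfolding countably_approximable_def by blast
  then have cover: "AE t in lebesgue. \<exists>j. dist (f t) (x j) < \<epsilon> / 2"
    by eventually_elim blast
  \<comment> \<open>Radii below \<open>\<epsilon>\<close> give the required closeness; staying above \<open>3 * \<epsilon> / 4\<close> leaves a gap to the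
    covering radius \<open>\<epsilon> / 2\<close> that does not depend on \<open>j\<close>.\<close>
  have "\<exists>r. 3 * \<epsilon> / 4 < r \<and> r < \<epsilon> \<and> (\<forall>c>0. thin_shell f (x j) r c)" for j
    using assms(2) by (intro thin_shell_radius_exists[OF f]) simp
  then obtain r where r: "\<And>j. 3 * \<epsilon> / 4 < r j" "\<And>j. r j < \<epsilon>"
    "\<And>j c. c > 0 \<Longrightarrow> thin_shell f (x j) (r j) c"
    by metis
  define B where "B j = {t. dist (f t) (x j) < r j}" for j
  have B: "translation_controlled f (B j)" for j
    unfolding B_def by (intro translation_controlled_ball ca r)
  define T where "T = disjointed B"
  have T: "translation_controlled f (T j)" for j
    unfolding T_def using B by (rule translation_controlled_disjointed)
  have meas: "T j \<in> sets lebesgue" for j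
    using T by (simp add: translation_controlled_def)
  have null: "emeasure lebesgue (UNIV - (\<Union>j. T j)) = 0"
  proof -
    have "AE t in lebesgue. t \<notin> UNIV - (\<Union>j. T j)"
      using cover
    proof eventually_elim
      case (elim t)
      then obtain j where "dist (f t) (x j) < \<epsilon> / 2" by blast
      then have "t \<in> B j" using r(1)[of j] assms(2) by (simp add: B_def)
      then show ?case unfolding T_def UN_disjointed_eq by blast
    qed
    then have "UNIV - (\<Union>j. T j) \<in> null_sets lebesgue"
      unfolding completion.null_sets_iff_AE by simp
    then show ?thesis by (rule null_setsD1)
  qed
  have norm: "(\<lambda>N. Weyl_norm (indicator (UNIV - (\<Union>j\<le>N. T j)))) \<longlonglongrightarrow> 0"
  proof (rule tendstoI)
    fix e :: real assume e: "e > 0"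
    obtain l N0 where l: "l > 0" and N0: "\<And>N. N \<ge> N0 \<Longrightarrow>
        mean_le l (indicator {t. \<forall>j\<le>N. 3 * \<epsilon> / 4 \<le> dist (f t) (x j)}) (e / 2)"
      using uniformly_small_tail[OF f cover, of "3 * \<epsilon> / 4" "e / 2"] assms(2) e by auto
    have "dist (Weyl_norm (indicator (UNIV - (\<Union>j\<le>N. T j)))) 0 < e" if N: "N \<ge> N0" for N
    proof -
      define A where "A = UNIV - (\<Union>j\<le>N. T j)"
      define C where "C = {t. \<forall>j\<le>N. 3 * \<epsilon> / 4 \<le> dist (f t) (x j)}"
      have A: "A \<in> sets lebesgue"
        unfolding A_def using meas by (intro sets.Diff sets.finite_UN) auto
      have C: "C \<in> sets lebesgue"
        unfolding C_def by (rule far_from_points_measurable[OF ca])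
      have "{..N} = {0..<Suc N}" by auto
      then have "(\<Union>j\<le>N. T j) = (\<Union>j\<le>N. B j)"
        unfolding T_def by (simp only: finite_UN_disjointed_eq)
      then have "r j \<le> dist (f t) (x j)" if "t \<in> A" "j \<le> N" for t j
        using that by (auto simp: A_def B_def not_less)
      then have "A \<subseteq> C"
        using r(1) unfolding C_def by (blast intro: less_imp_le order_trans)
      then have sub: "indicator A t \<le> indicator C t + 0 * (indicator C t :: real)" for t
        by (auto simp: indicator_def)
      have "mean_le l (indicator A) (e / 2 + 0 * (e / 2))"
        using N0[OF N] unfolding C_def[symmetric]
        by (intro mean_le_combine[OF unit_fun_indicator[OF A] sub
              unit_fun_indicator[OF C] unit_fun_indicator[OF C]]) auto
      from Weyl_norm_bounds[OF unit_fun_indicator[OF A] this l] e show ?thesis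
        by (simp add: A_def[symmetric] dist_real_def)
    qed
    then show "\<forall>\<^sub>F N in sequentially. dist (Weyl_norm (indicator (UNIV - (\<Union>j\<le>N. T j)))) 0 < e"
      by (rule eventually_sequentiallyI)
  qed
  have "T \<in> Weyl_partitions (Mod_fun f)"
    unfolding Weyl_partitions_def
    using translation_controlled_Weyl_set[OF f T] null norm
    by (auto simp: T_def disjoint_family_disjointed)
  moreover have "dist (f t) (x j) < \<epsilon>" if "t \<in> T j" for t j
  proof -
    have "t \<in> B j"
      using disjointed_subset[of B j] that unfolding T_def by blast
    then show ?thesis using r(2)[of j] by (simp add: B_def)
  qed
  ultimately show ?thesis by blast
qed

end
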